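(* Let $(X_1,Y_1),\ldots,(X_n,Y_n)$ be i.i.d. samples from the Laplace gating Gaussian mixture of experts $p_{G_*}(Y|X)$ with $k_*$ experts, let $k>k_*$ (the true number $k_*$ being unknown), and let $\widehat{G}_n\in\arg\max_{G\in\mathcal{G}_k(\Theta)}\frac1n\sum_{i=1}^n\log p_G(Y_i|X_i)$ be the maximum likelihood estimator. Then the density estimator $p_{\widehat{G}_n}(Y|X)$ converges to the true density $p_{G_*}(Y|X)$ in Total Variation distance at the rate $$\mathbb{E}_X\big[V(p_{\widehat{G}_n}(\cdot|X),p_{G_*}(\cdot|X))\big]=\mathcal{O}\big(\sqrt{\log(n)/n}\big),$$ in the sense that there are positive constants $C,c_1,c_2$, not depending on $n$, such that $$\mathbb{P}\Big(\mathbb{E}_X\big[V(p_{\widehat{G}_n}(\cdot|X),p_{G_*}(\cdot|X))\big]>C\sqrt{\log(n)/n}\Big)\le c_1 n^{-c_2}.$$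
   Context: Model: for $v=(v_i)_{i=1}^{m}$ write $\mathrm{Softmax}(v_i):=\exp(v_i)/\sum_{j=1}^{m}\exp(v_j)$. Let $f(\cdot|\mu,\nu)$ be the univariate Gaussian density with mean $\mu$ and variance $\nu$. A mixing measure is $G=\sum_{i=1}^{k'}\exp(\beta_i)\delta_{(W_i,a_i,b_i,\nu_i)}$ with $\beta_i\in\mathbb{R}$, $W_i,a_i\in\mathbb{R}^d$, $b_i\in\mathbb{R}$, $\nu_i>0$ ($\delta$ is the Dirac measure), and it induces the Laplace gating Gaussian mixture-of-experts conditional density $$p_G(Y|X)=\sum_{i=1}^{k'}\mathrm{Softmax}\big(-\|W_i-X\|+\beta_i\big)\, f(Y|a_i^{\top}X+b_i,\nu_i),$$ the Softmax being taken over the $k'$ components, and $\|\cdot\|$ the Euclidean norm. The parameter set $\Theta$ is a compact set of parameters $(\beta,W,a,b,\nu)\in\mathbb{R}\times\mathbb{R}^d\times\mathbb{R}^d\times\mathbb{R}\times(0,\infty)$ (so $\nu$ is bounded away from $0$ on $\Theta$). $\mathcal{G}_k(\Theta)$ is the set of all mixing measures $\sum_{i=1}^{k'}\exp(\beta_i)\delta_{(W_i,a_i,b_i,\nu_i)}$ with $1\le k'\le k$ components and all parameters in $\Theta$; the last weight parameter is normalized to be zero, $\beta_{k'}=0$. The true mixing measure is $G_*=\sum_{i=1}^{k_*}\exp(\beta_i^* )\delta_{(W_i^*,a_i^*,b_i^*,\nu_i^* )}$, with parameters in $\Theta$ and the same normalization ($\beta^*_{k_*}=0$). The $X_i$ are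 i.i.d. and take values in a bounded set $\mathcal{X}\subset\mathbb{R}^d$; given $X_i$, $Y_i\in\mathbb{R}$ has density $p_{G_*}(\cdot|X_i)$. $\mathbb{E}_X$ is the expectation over a fresh $X$ with the same law as the $X_i$. For densities $p,q$ with respect to Lebesgue measure $\mu$, $V(p,q)=\frac12\int|p-q|\,d\mu$. *)

theory Defs
  imports "HOL-Probability.Probability"
begin

text \<open>A component is \<open>(\<beta>, W, a, b, \<nu>)\<close>; its atom is the part \<open>(W, a, b, \<nu>)\<close>.\<close>

type_synonym 'v atom = "'v \<times> 'v \<times> real \<times> real"
type_synonym 'v component = "real \<times> 'v atom"

definition softmax :: "nat \<Rightarrow> (nat \<Rightarrow> real) \<Rightarrow> nat \<Rightarrow> real" where
  "softmax m v i = exp (v i) / (\<Sum>j<m. exp (v j))"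

definition gate_score :: "'v::euclidean_space component \<Rightarrow> 'v \<Rightarrow> real" where
  "gate_score = (\<lambda>(\<beta>, W, a, b, \<nu>) x. - norm (W - x) + \<beta>)"

text \<open>\<open>normal_density\<close> takes the standard deviation, whereas \<open>\<nu>\<close> is the variance.\<close>

definition expert_density :: "'v::euclidean_space component \<Rightarrow> 'v \<Rightarrow> real \<Rightarrow> real" where
  "expert_density = (\<lambda>(\<beta>, W, a, b, \<nu>) x y. normal_density (a \<bullet> x + b) (sqrt \<nu>) y)"

definition moe_density :: "'v::euclidean_space component list \<Rightarrow> 'v \<Rightarrow> real \<Rightarrow> real" where
  "moe_density ps x y =
     (\<Sum>i<length ps. softmax (length ps) (\<lambda>j. gate_score (ps ! j) x) i * expert_density (ps ! i) x y)"

text \<open>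
  The measure \<open>\<Sum>\<^sub>i exp \<beta>\<^sub>i \<delta>\<^bsub>(W\<^sub>i, a\<^sub>i, b\<^sub>i, \<nu>\<^sub>i)\<^esub>\<close>, obtained as the image of the weights on the index set
  under \<open>i \<mapsto> (W\<^sub>i, a\<^sub>i, b\<^sub>i, \<nu>\<^sub>i)\<close>; see \<open>emeasure_mixing_measure\<close>.
\<close>

definition mixing_measure :: "'v::euclidean_space component list \<Rightarrow> 'v atom measure" where
  "mixing_measure ps =
     distr (point_measure {..<length ps} (\<lambda>i. ennreal (exp (fst (ps ! i))))) borel (\<lambda>i. snd (ps ! i))"

text \<open>
  The density \<open>p\<^sub>G(y|x)\<close> of a mixing measure. The choice of the representation is immaterial
  (reordering, splitting or merging equal atoms does not change the density); see
  \<open>cond_density_mixing_measure\<close>.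
\<close>

definition cond_density :: "'v::euclidean_space atom measure \<Rightarrow> 'v \<Rightarrow> real \<Rightarrow> real" where
  "cond_density G = moe_density (SOME ps. G = mixing_measure ps)"

definition mixing_measures :: "nat \<Rightarrow> 'v::euclidean_space component set \<Rightarrow> 'v atom measure set" where
  "mixing_measures k \<Theta> =
     {mixing_measure ps | ps. 1 \<le> length ps \<and> length ps \<le> k \<and> set ps \<subseteq> \<Theta> \<and> fst (last ps) = 0}"

definition avg_log_lik ::
  "nat \<Rightarrow> (nat \<Rightarrow> 'v::euclidean_space) \<Rightarrow> (nat \<Rightarrow> real) \<Rightarrow> 'v atom measure \<Rightarrow> real" where
  "avg_log_lik n x y G = (1 / real n) * (\<Sum>i<n. ln (cond_density G (x i) (y i)))"

definition is_mle ::
  "nat \<Rightarrow> 'v::euclidean_space component set \<Rightarrow> nat \<Rightarrow> (nat \<Rightarrow> 'v) \<Rightarrow> (nat \<Rightarrow> real) \<Rightarrow> 'v atom measure \<Rightarrow> bool"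
  where
  "is_mle k \<Theta> n x y G \<longleftrightarrow> is_arg_max (avg_log_lik n x y) (\<lambda>G. G \<in> mixing_measures k \<Theta>) G"

definition tv_dist :: "(real \<Rightarrow> real) \<Rightarrow> (real \<Rightarrow> real) \<Rightarrow> real" where
  "tv_dist p q = 1 / 2 * (\<integral>y. \<bar>p y - q y\<bar> \<partial>lborel)"

text \<open>
  \<open>(X\<^sub>0, Y\<^sub>0), \<dots>, (X\<^bsub>n-1\<^esub>, Y\<^bsub>n-1\<^esub>)\<close> are i.i.d. under \<open>M\<close>, each \<open>X\<^sub>i\<close> has law \<open>PX\<close>, and given \<open>X\<^sub>i = x\<close>,
  \<open>Y\<^sub>i\<close> has Lebesgue density \<open>p x\<close>: the joint law has density \<open>p\<close> with respect to \<open>PX \<Otimes> lborel\<close>.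
\<close>

definition iid_sample ::
  "'w measure \<Rightarrow> 'v::euclidean_space measure \<Rightarrow> ('v \<Rightarrow> real \<Rightarrow> real) \<Rightarrow>
   nat \<Rightarrow> (nat \<Rightarrow> 'w \<Rightarrow> 'v) \<Rightarrow> (nat \<Rightarrow> 'w \<Rightarrow> real) \<Rightarrow> bool" where
  "iid_sample M PX p n X Y \<longleftrightarrow>
     prob_space M \<and>
     prob_space.indep_vars M (\<lambda>_. borel \<Otimes>\<^sub>M borel) (\<lambda>i \<omega>. (X i \<omega>, Y i \<omega>)) {..<n} \<and>
     (\<forall>i<n. distr M (borel \<Otimes>\<^sub>M borel) (\<lambda>\<omega>. (X i \<omega>, Y i \<omega>)) =
              density (PX \<Otimes>\<^sub>M lborel) (\<lambda>(x, y). ennreal (p x y)))"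

lemma space_mixing_measure [simp]: "space (mixing_measure ps) = UNIV"
  and sets_mixing_measure [simp, measurable_cong]: "sets (mixing_measure ps) = sets borel"
  by (simp_all add: mixing_measure_def)

lemma nn_integral_mixing_measure:
  assumes "g \<in> borel_measurable borel"
  shows "(\<integral>\<^sup>+ t. g t \<partial>mixing_measure ps) = (\<Sum>i<length ps. ennreal (exp (fst (ps ! i))) * g (snd (ps ! i)))"
  unfolding mixing_measure_def
  by (subst nn_integral_distr)
     (use assms in \<open>auto simp: nn_integral_point_measure_finite measurable_def space_point_measure
        sets_point_measure\<close>)

lemma emeasure_mixing_measure:
  assumes "A \<in> sets borel"
  shows "emeasure (mixing_measure ps) A =
           (\<Sum>i<length ps. ennreal (exp (fst (ps ! i))) * emeasure (return borel (snd (ps ! i))) A)"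
proof -
  have "emeasure (mixing_measure ps) A = (\<integral>\<^sup>+ t. indicator A t \<partial>mixing_measure ps)"
    using assms by (simp add: nn_integral_indicator)
  also have "\<dots> = (\<Sum>i<length ps. ennreal (exp (fst (ps ! i))) * indicator A (snd (ps ! i)))"
    using assms by (intro nn_integral_mixing_measure) simp
  finally show ?thesis using assms by simp
qed

lemma sum_eq_integral_mixing_measure:
  assumes "g \<in> borel_measurable borel" "\<And>t. 0 \<le> g t"
  shows "(\<Sum>i<length ps. exp (fst (ps ! i)) * g (snd (ps ! i))) =
           enn2real (\<integral>\<^sup>+ t. ennreal (g t) \<partial>mixing_measure ps)"
proof -
  have "(\<integral>\<^sup>+ t. ennreal (g t) \<partial>mixing_measure ps) =
          (\<Sum>i<length ps. ennreal (exp (fst (ps ! i)) * g (snd (ps ! i))))"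
    using assms by (subst nn_integral_mixing_measure) (auto simp: ennreal_mult)
  also have "\<dots> = ennreal (\<Sum>i<length ps. exp (fst (ps ! i)) * g (snd (ps ! i)))"
    using assms by (intro sum_ennreal) auto
  finally show ?thesis using assms by (simp add: sum_nonneg)
qed

lemma moe_density_eq_integrals:
  fixes ps :: "'v::euclidean_space component list"
  shows "moe_density ps x y =
    enn2real (\<integral>\<^sup>+ t. ennreal (exp (- norm (fst t - x)) *
       normal_density (fst (snd t) \<bullet> x + fst (snd (snd t))) (sqrt (snd (snd (snd t)))) y) \<partial>mixing_measure ps) /
    enn2real (\<integral>\<^sup>+ t. ennreal (exp (- norm (fst t - x))) \<partial>mixing_measure ps)"
proof -
  have meas: "(\<lambda>t::'v atom. exp (- norm (fst t - x))) \<in> borel_measurable borel"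
    by (intro borel_measurable_continuous_onI continuous_intros)
  have measf: "fst \<in> borel_measurable (borel :: ('v atom) measure)"
    "(\<lambda>t. fst (snd t)) \<in> borel_measurable (borel :: ('v atom) measure)"
    "(\<lambda>t. fst (snd (snd t))) \<in> borel_measurable (borel :: ('v atom) measure)"
    "(\<lambda>t. snd (snd (snd t))) \<in> borel_measurable (borel :: ('v atom) measure)"
    by (intro borel_measurable_continuous_onI continuous_intros)+
  have meas2: "(\<lambda>t::'v atom. exp (- norm (fst t - x)) *
       normal_density (fst (snd t) \<bullet> x + fst (snd (snd t))) (sqrt (snd (snd (snd t)))) y)
       \<in> borel_measurable borel"
    using measf meas unfolding normal_density_def by measurable
  have gate: "exp (gate_score (ps ! j) x) = exp (fst (ps ! j)) * exp (- norm (fst (snd (ps ! j)) - x))" for j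
    unfolding gate_score_def case_prod_beta exp_add by (rule mult.commute)
  have "moe_density ps x y =
      (\<Sum>i<length ps. exp (gate_score (ps ! i) x) * expert_density (ps ! i) x y) /
      (\<Sum>j<length ps. exp (gate_score (ps ! j) x))"
    unfolding moe_density_def softmax_def sum_divide_distrib times_divide_eq_left ..
  then show ?thesis
    unfolding gate expert_density_def case_prod_beta mult.assoc
      sum_eq_integral_mixing_measure[OF meas exp_ge_zero]
      sum_eq_integral_mixing_measure[OF meas2 mult_nonneg_nonneg[OF exp_ge_zero normal_density_nonneg]] .
qed

lemma moe_density_cong:
  assumes "mixing_measure ps = mixing_measure qs"
  shows "moe_density ps x y = moe_density qs x y"
  unfolding moe_density_eq_integrals assms ..

lemma cond_density_mixing_measure: "cond_density (mixing_measure ps) = moe_density ps"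
proof -
  have "mixing_measure ps = mixing_measure (SOME qs. mixing_measure ps = mixing_measure qs)"
    by (rule someI[of _ ps]) (rule refl)
  from moe_density_cong[OF this] show ?thesis
    unfolding cond_density_def by (intro ext) (rule sym)
qed

end

(*
Enlarging the variance of a Gaussian slightly absorbs small changes of its mean and variance, so
if the components of G and G' are within distance s of each other, then p_G <= exp (c s) q
pointwise, where q is p_G' with all variances increased by 2 s. A net of mesh 1/n in \<Theta> has polynomial
cardinality and hence yields polynomially many densities q such that every likelihood of a sample
of size n is at most exp c times the likelihood of some q. If the maximum likelihood estimator
is at L1 distance at least A from the truth p, then so is such a q up to O(1/n), although its
likelihood is at least exp (-c) times that of p. By Markov's inequality for the square root of
the likelihood ratio this has probability at most exp (c/2) times the n-th power of the affinity
of p and q, which is at most exp (c/2 - n A^2 / 8). With A of order sqrt (log n / n), the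
exponential beats the cardinality of the net.
*)

theory Submission
  imports Defs
begin

section \<open>Variance inflation of Gaussian experts\<close>

text \<open>The difference of the two sides is a square over a positive denominator: a weighted
  Cauchy-Schwarz inequality with weights \<nu> and \<open>\<tau> - \<nu>\<close>. It lets a shift of
  the mean be paid for by excess variance.\<close>

lemma shifted_square_le:
  fixes a b \<nu> \<tau> :: real
  assumes "0 < \<nu>" "\<nu> < \<tau>"
  shows "(a + b)\<^sup>2 / \<tau> \<le> a\<^sup>2 / \<nu> + b\<^sup>2 / (\<tau> - \<nu>)"
proof -
  have "a\<^sup>2 / \<nu> + b\<^sup>2 / (\<tau> - \<nu>) - (a + b)\<^sup>2 / \<tau> = (a * (\<tau> - \<nu>) - b * \<nu>)\<^sup>2 / (\<nu> * (\<tau> - \<nu>) * \<tau>)"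
    using assms by (simp add: field_simps) algebra
  moreover have "\<dots> \<ge> 0"
    using assms by simp
  ultimately show ?thesis by linarith
qed

text \<open>The root is the quotient of the normalizing constants, and the exponential is what
  \<open>shifted_square_le\<close> yields for the exponents. Neither factor depends on
  \<open>y\<close>, so the domination is uniform over the unbounded response.\<close>

lemma normal_density_le_inflated:
  fixes m m' \<nu> \<tau> y :: real
  assumes "0 < \<nu>" "\<nu> < \<tau>"
  shows "normal_density m (sqrt \<nu>) y
    \<le> sqrt (\<tau> / \<nu>) * exp ((m - m')\<^sup>2 / (2 * (\<tau> - \<nu>))) * normal_density m' (sqrt \<tau>) y"
proof -
  have half: "u / 2 \<le> v / 2 + w / 2" if "u \<le> v + w" for u v w :: real
    using that by simp
  have "(y - m')\<^sup>2 / \<tau> / 2 \<le> (y - m)\<^sup>2 / \<nu> / 2 + (m - m')\<^sup>2 / (\<tau> - \<nu>) / 2"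
    using shifted_square_le[OF assms, of "y - m" "m - m'"] by (intro half) simp
  then have "exp (- (y - m)\<^sup>2 / (2 * \<nu>)) \<le> exp ((m - m')\<^sup>2 / (2 * (\<tau> - \<nu>)) + - (y - m')\<^sup>2 / (2 * \<tau>))"
    unfolding exp_le_cancel_iff divide_divide_eq_left mult.commute[of 2] minus_divide_left[symmetric]
    by (simp only: divide_divide_eq_left)
  moreover have "1 / sqrt (2 * pi * \<nu>) = sqrt (\<tau> / \<nu>) * (1 / sqrt (2 * pi * \<tau>))"
    using assms by (simp add: real_sqrt_mult real_sqrt_divide)
  moreover have "0 \<le> sqrt (\<tau> / \<nu>) * (1 / sqrt (2 * pi * \<tau>))"
    using assms by simp
  ultimately have "1 / sqrt (2 * pi * \<nu>) * exp (- (y - m)\<^sup>2 / (2 * \<nu>))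
      \<le> sqrt (\<tau> / \<nu>) * (1 / sqrt (2 * pi * \<tau>)) *
          exp ((m - m')\<^sup>2 / (2 * (\<tau> - \<nu>)) + - (y - m')\<^sup>2 / (2 * \<tau>))"
    by (metis mult_left_mono)
  moreover have "(sqrt \<nu>)\<^sup>2 = \<nu>" "(sqrt \<tau>)\<^sup>2 = \<tau>"
    using assms by simp_all
  ultimately show ?thesis
    unfolding normal_density_def exp_add by (simp only: mult_ac)
qed

text \<open>Inflated components may leave \<Theta>; they occur only in comparison densities, never
  as candidates for the estimator.\<close>

definition inflate :: "real \<Rightarrow> 'v::euclidean_space component \<Rightarrow> 'v component" where
  "inflate s = (\<lambda>(\<beta>, W, a, b, \<nu>). (\<beta>, W, a, b, \<nu> + s))"

abbreviation variance_of :: "'v::euclidean_space component \<Rightarrow> real" where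
  "variance_of \<theta> \<equiv> snd (snd (snd (snd \<theta>)))"

lemma gate_score_inflate [simp]: "gate_score (inflate s \<theta>) x = gate_score \<theta> x"
  by (simp add: gate_score_def inflate_def case_prod_beta)

lemma variance_of_inflate [simp]: "variance_of (inflate s \<theta>) = variance_of \<theta> + s"
  by (simp add: inflate_def case_prod_beta)

text \<open>One \<eta> comes from the bias, the other from \<open>W\<close>, because the norm is
  1-Lipschitz.\<close>

lemma gate_score_diff_le:
  assumes "dist \<theta> \<theta>' \<le> \<eta>"
  shows "\<bar>gate_score \<theta> x - gate_score \<theta>' x\<bar> \<le> 2 * \<eta>"
proof -
  have "dist (fst \<theta>) (fst \<theta>') \<le> \<eta>" "dist (fst (snd \<theta>)) (fst (snd \<theta>')) \<le> \<eta>"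
    using assms dist_fst_le[of \<theta> \<theta>'] dist_snd_le[of \<theta> \<theta>'] dist_fst_le[of "snd \<theta>" "snd \<theta>'"] by linarith+
  moreover have "\<bar>norm (fst (snd \<theta>) - x) - norm (fst (snd \<theta>') - x)\<bar> \<le> dist (fst (snd \<theta>)) (fst (snd \<theta>'))"
    using norm_triangle_ineq3[of "fst (snd \<theta>) - x" "fst (snd \<theta>') - x"] by (simp add: dist_norm)
  ultimately show ?thesis
    by (simp add: gate_score_def case_prod_beta dist_real_def)
qed

text \<open>The variance gap must be at least of order \<eta>, so that the squared mean shift
  divided by it is still of order \<eta>, and at most of order \<eta>, so that the normalizing
  constants stay close. Inflating by \<open>2 * \<eta>\<close> achieves both: since the original
  variances differ by at most \<eta>, the gap lies between \<eta> and
  \<open>3 * \<eta>\<close>.\<close>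

lemma expert_density_le_inflated:
  assumes "dist \<theta> \<theta>' \<le> \<eta>" "0 < \<eta>" "0 < \<nu>0" "\<nu>0 \<le> variance_of \<theta>" "norm x \<le> R"
  shows "expert_density \<theta> x y
    \<le> exp ((3 / (2 * \<nu>0) + (R + 1)\<^sup>2 / 2) * \<eta>) * expert_density (inflate (2 * \<eta>) \<theta>') x y"
proof -
  obtain \<beta> W a b \<nu> where \<theta>: "\<theta> = (\<beta>, W, a, b, \<nu>)" by (cases \<theta>)
  obtain \<beta>' W' a' b' \<nu>' where \<theta>': "\<theta>' = (\<beta>', W', a', b', \<nu>')" by (cases \<theta>')
  have d: "dist (snd (snd (\<theta>))) (snd (snd \<theta>')) \<le> \<eta>"
    using assms(1) dist_snd_le[of \<theta> \<theta>'] dist_snd_le[of "snd \<theta>" "snd \<theta>'"] by linarith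
  have d': "dist (snd (snd (snd \<theta>))) (snd (snd (snd \<theta>'))) \<le> \<eta>"
    using d dist_snd_le[of "snd (snd \<theta>)" "snd (snd \<theta>')"] by linarith
  have a: "dist a a' \<le> \<eta>"
    using d dist_fst_le[of "snd (snd \<theta>)" "snd (snd \<theta>')"] by (simp add: \<theta> \<theta>')
  have b: "\<bar>b - b'\<bar> \<le> \<eta>"
    using d' dist_fst_le[of "snd (snd (snd \<theta>))" "snd (snd (snd \<theta>'))"] by (simp add: \<theta> \<theta>' dist_real_def)
  have \<nu>: "\<bar>\<nu> - \<nu>'\<bar> \<le> \<eta>"
    using d' dist_snd_le[of "snd (snd (snd \<theta>))" "snd (snd (snd \<theta>'))"] by (simp add: \<theta> \<theta>' dist_real_def)
  have \<nu>0: "\<nu>0 \<le> \<nu>" using assms by (simp add: \<theta>)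
  define m m' \<tau> where "m = a \<bullet> x + b" and "m' = a' \<bullet> x + b'" and "\<tau> = \<nu>' + 2 * \<eta>"
  have \<tau>: "\<nu> + \<eta> \<le> \<tau>" "\<tau> \<le> \<nu> + 3 * \<eta>" using \<nu> by (auto simp: \<tau>_def)
  have "\<bar>(a - a') \<bullet> x\<bar> \<le> \<eta> * R"
    using a assms by (intro order.trans[OF Cauchy_Schwarz_ineq2] mult_mono) (auto simp: dist_norm)
  then have "\<bar>m - m'\<bar> \<le> (R + 1) * \<eta>"
    using b by (simp add: m_def m'_def inner_diff_left algebra_simps)
  then have "(m - m')\<^sup>2 \<le> ((R + 1) * \<eta>)\<^sup>2"
    using abs_le_square_iff[of "m - m'" "(R + 1) * \<eta>"] by linarith
  then have "(m - m')\<^sup>2 / (2 * (\<tau> - \<nu>)) \<le> ((R + 1) * \<eta>)\<^sup>2 / (2 * \<eta>)"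
    using \<tau> assms by (intro frac_le) auto
  also have "\<dots> = (R + 1)\<^sup>2 / 2 * \<eta>"
    using assms by (simp add: power2_eq_square)
  finally have E: "exp ((m - m')\<^sup>2 / (2 * (\<tau> - \<nu>))) \<le> exp ((R + 1)\<^sup>2 / 2 * \<eta>)" by simp
  \<comment> \<open>The square root will halve the exponent \<open>3 * \<eta> / \<nu>0\<close>,
    whence the constant \<open>3 / (2 * \<nu>0)\<close>.\<close>
  have "\<tau> / \<nu> \<le> 1 + 3 * \<eta> / \<nu>"
    using \<tau> \<nu>0 assms by (simp add: field_simps)
  also have "\<dots> \<le> 1 + 3 * \<eta> / \<nu>0"
    using \<nu>0 assms by (simp add: frac_le)
  also have "\<dots> \<le> exp (3 * \<eta> / \<nu>0)" by (rule exp_ge_add_one_self)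
  also have "\<dots> = (exp (3 / (2 * \<nu>0) * \<eta>))\<^sup>2"
    by (simp flip: exp_of_nat_mult add: field_simps)
  finally have S: "sqrt (\<tau> / \<nu>) \<le> exp (3 / (2 * \<nu>0) * \<eta>)"
    by (simp add: real_le_lsqrt)
  have "normal_density m (sqrt \<nu>) y
      \<le> sqrt (\<tau> / \<nu>) * exp ((m - m')\<^sup>2 / (2 * (\<tau> - \<nu>))) * normal_density m' (sqrt \<tau>) y"
    using \<tau> \<nu>0 assms by (intro normal_density_le_inflated) auto
  also have "\<dots> \<le> exp (3 / (2 * \<nu>0) * \<eta>) * exp ((R + 1)\<^sup>2 / 2 * \<eta>) * normal_density m' (sqrt \<tau>) y"
    using E S \<tau> \<nu>0 assms by (intro mult_mono) auto
  finally show ?thesis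
    by (simp add: expert_density_def inflate_def \<theta> \<theta>' m_def m'_def \<tau>_def exp_add ring_distribs)
qed

section \<open>Softmax weights and domination of mixtures\<close>

lemma softmax_nonneg: "0 \<le> softmax m v i"
  by (simp add: softmax_def sum_nonneg)

lemma softmax_pos: "i < m \<Longrightarrow> 0 < softmax m v i"
  unfolding softmax_def by (intro divide_pos_pos exp_gt_zero sum_pos) auto

lemma sum_softmax: "1 \<le> m \<Longrightarrow> (\<Sum>i<m. softmax m v i) = 1"
  using sum_pos[of "{..<m}" "\<lambda>i. exp (v i)"]
  by (auto simp: softmax_def lessThan_empty_iff simp flip: sum_divide_distrib)

text \<open>The numerator costs one factor \<open>exp \<delta>\<close> and the normalizing sum
  another.\<close>

lemma softmax_le_exp_mult:
  assumes "\<And>j. j < m \<Longrightarrow> \<bar>v j - w j\<bar> \<le> \<delta>" "i < m"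
  shows "softmax m v i \<le> exp (2 * \<delta>) * softmax m w i"
proof -
  have pos: "0 < (\<Sum>j<m. exp (u j))" for u :: "nat \<Rightarrow> real"
    using assms(2) by (intro sum_pos) auto
  have "(\<Sum>j<m. exp (w j)) \<le> (\<Sum>j<m. exp \<delta> * exp (v j))"
    using assms(1) by (intro sum_mono) (force simp flip: exp_add)
  also have "\<dots> = exp \<delta> * (\<Sum>j<m. exp (v j))" by (simp add: sum_distrib_left)
  finally have D: "(\<Sum>j<m. exp (w j)) \<le> exp \<delta> * (\<Sum>j<m. exp (v j))" .
  have N: "exp (v i) \<le> exp \<delta> * exp (w i)"
    using assms(1)[OF assms(2)] by (simp flip: exp_add)
  have "exp (v i) * (\<Sum>j<m. exp (w j)) \<le> (exp \<delta> * exp (w i)) * (exp \<delta> * (\<Sum>j<m. exp (v j)))"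
    by (intro mult_mono N D sum_nonneg) auto
  also have "\<dots> = exp (2 * \<delta>) * exp (w i) * (\<Sum>j<m. exp (v j))"
    by (simp add: mult_exp_exp mult_ac)
  finally show ?thesis
    unfolding softmax_def using pos[of v] pos[of w] by (simp add: field_simps)
qed

lemma expert_density_nonneg: "0 \<le> expert_density \<theta> x y"
  by (simp add: expert_density_def case_prod_beta)

lemma moe_density_nonneg: "0 \<le> moe_density ps x y"
  unfolding moe_density_def by (intro sum_nonneg mult_nonneg_nonneg softmax_nonneg expert_density_nonneg)

lemma moe_density_pos:
  assumes "1 \<le> length ps" "\<And>\<theta>. \<theta> \<in> set ps \<Longrightarrow> 0 < variance_of \<theta>"
  shows "0 < moe_density ps x y"
  unfolding moe_density_def
  using assms(1) by (intro sum_pos mult_pos_pos softmax_pos)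
    (auto simp: expert_density_def case_prod_beta lessThan_empty_iff intro!: normal_density_pos assms(2))

text \<open>Components are compared index by index. Gate scores move by at most
  \<open>2 * \<eta>\<close>, which the softmax doubles: this is the summand 4 of the constant, and
  the experts contribute the rest. As the exponent is linear in \<eta>, a mesh of 1/n keeps the
  accumulated factor over n observations bounded.\<close>

lemma moe_density_le_inflated:
  assumes len: "length ps = length qs"
    and dist: "\<And>i. i < length ps \<Longrightarrow> dist (ps ! i) (qs ! i) \<le> \<eta>"
    and \<nu>0: "0 < \<nu>0" "\<And>\<theta>. \<theta> \<in> set ps \<Longrightarrow> \<nu>0 \<le> variance_of \<theta>"
    and "0 < \<eta>" "norm x \<le> R"
  shows "moe_density ps x y
    \<le> exp ((4 + 3 / (2 * \<nu>0) + (R + 1)\<^sup>2 / 2) * \<eta>) * moe_density (map (inflate (2 * \<eta>)) qs) x y"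
proof -
  let ?m = "length qs" and ?c = "3 / (2 * \<nu>0) + (R + 1)\<^sup>2 / 2"
  have sm: "softmax ?m (\<lambda>j. gate_score (map (inflate (2 * \<eta>)) qs ! j) x) i = softmax ?m (\<lambda>j. gate_score (qs ! j) x) i"
    if "i < ?m" for i using that by (simp add: softmax_def)
  have "moe_density ps x y \<le> (\<Sum>i<?m. (exp (2 * (2 * \<eta>)) * softmax ?m (\<lambda>j. gate_score (qs ! j) x) i) *
      (exp (?c * \<eta>) * expert_density (inflate (2 * \<eta>) (qs ! i)) x y))"
    unfolding moe_density_def len
    using assms by (intro sum_mono mult_mono softmax_le_exp_mult gate_score_diff_le
        expert_density_le_inflated expert_density_nonneg mult_nonneg_nonneg softmax_nonneg) auto
  also have "\<dots> = exp ((4 + ?c) * \<eta>) * moe_density (map (inflate (2 * \<eta>)) qs) x y"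
    unfolding moe_density_def sum_distrib_left length_map
    by (intro sum.cong refl) (subst sm, simp_all add: exp_add ring_distribs mult_ac)
  finally show ?thesis by (simp add: add.assoc)
qed

section \<open>Nets of polynomial size\<close>

text \<open>Space is cut into cubes of side 1/(n DIM), and one point of \<open>S\<close> is kept
  from each cube that meets \<open>S\<close>. Points of the same cube differ by at most 1/(n DIM) in
  every coordinate, hence by at most 1/n in the l1 norm, which dominates the Euclidean one.\<close>

lemma polynomial_net:
  fixes S :: "'a::euclidean_space set"
  assumes "bounded S"
  obtains K where "1 \<le> K"
    "\<And>n::nat. 1 \<le> n \<Longrightarrow> \<exists>T\<subseteq>S. finite T \<and> real (card T) \<le> K * real n ^ DIM('a) \<and>
       (\<forall>x\<in>S. \<exists>t\<in>T. dist x t \<le> 1 / real n)"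
proof -
  obtain B where B: "0 < B" "\<And>x. x \<in> S \<Longrightarrow> norm x \<le> B"
    using assms bounded_pos by blast
  have floor_diff_le: "\<bar>v - u\<bar> \<le> 1" if "\<lfloor>u\<rfloor> = \<lfloor>v\<rfloor>" for u v :: real
    using that by linarith
  let ?D = "real DIM('a)"
  have D: "1 \<le> ?D" using DIM_positive[where 'a='a] by linarith
  show thesis
  proof (rule that)
    show "1 \<le> (2 * ?D * B + 3) ^ DIM('a)"
      using B D by (intro one_le_power) (simp add: add_nonneg_nonneg)
  next
    fix n :: nat assume n: "1 \<le> n"
    define L where "L = \<lceil>n * ?D * B\<rceil>"
    have "0 \<le> n * ?D * B" using B by simp
    then have L: "0 \<le> L" "L \<le> n * ?D * B + 1" unfolding L_def by linarith+
    \<comment> \<open>\<open>g\<close> names the cube of a point; \<open>restrict\<close> places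
      this name in a \<open>PiE\<close> set, whose cardinality is known.\<close>
    define g where "g = (\<lambda>x::'a. restrict (\<lambda>i. \<lfloor>n * ?D * (x \<bullet> i)\<rfloor>) Basis)"
    \<comment> \<open>Choosing representatives inside \<open>S\<close> matters later: net points
      taken from \<Theta> have positive variance.\<close>
    define T where "T = inv_into S g ` g ` S"
    have TS: "T \<subseteq> S" by (auto simp: T_def inv_into_into)
    have "g ` S \<subseteq> PiE Basis (\<lambda>_. {- L..L})"
    proof (clarsimp simp: g_def)
      fix x and i :: 'a assume "x \<in> S" "i \<in> Basis"
      then have "\<bar>x \<bullet> i\<bar> \<le> B" using B(2) Basis_le_norm order.trans by blast
      then have "\<bar>n * ?D * (x \<bullet> i)\<bar> \<le> n * ?D * B"
        by (simp add: abs_mult mult_left_mono)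
      then show "- L \<le> \<lfloor>n * ?D * (x \<bullet> i)\<rfloor> \<and> \<lfloor>n * ?D * (x \<bullet> i)\<rfloor> \<le> L"
        unfolding L_def by linarith
    qed
    moreover have fin: "finite (PiE (Basis::'a set) (\<lambda>_. {- L..L}))"
      by (intro finite_PiE) auto
    ultimately have gS: "finite (g ` S)" "card (g ` S) \<le> card (PiE (Basis::'a set) (\<lambda>_. {- L..L}))"
      by (auto intro: finite_subset card_mono)
    have "real (card T) \<le> real (card (PiE (Basis::'a set) (\<lambda>_. {- L..L})))"
      using gS card_image_le[of "g ` S" "inv_into S g"] by (simp add: T_def)
    also have "\<dots> = (2 * real_of_int L + 1) ^ DIM('a)"
      using L(1) by (simp add: card_PiE add.commute)
    also have "\<dots> \<le> ((2 * ?D * B + 3) * n) ^ DIM('a)"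
    proof (intro power_mono)
      \<comment> \<open>The additive 3, from rounding up in \<open>L\<close> and from the cell 0, is
        absorbed by \<open>1 \<le> n\<close>.\<close>
      show "2 * real_of_int L + 1 \<le> (2 * ?D * B + 3) * n"
        using L(2) n by (simp add: algebra_simps)
    qed (use L(1) in simp)
    finally have "real (card T) \<le> (2 * ?D * B + 3) ^ DIM('a) * real n ^ DIM('a)"
      by (simp add: power_mult_distrib)
    moreover have "\<exists>t\<in>T. dist x t \<le> 1 / real n" if "x \<in> S" for x
    proof
      define t where "t = inv_into S g (g x)"
      show "t \<in> T" using that by (simp add: T_def t_def)
      have "g t = g x" using that by (simp add: t_def f_inv_into_f)
      then have "\<lfloor>n * ?D * (t \<bullet> i)\<rfloor> = \<lfloor>n * ?D * (x \<bullet> i)\<rfloor>" if "i \<in> Basis" for i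
        using that by (auto dest!: fun_cong[where x = i] simp: g_def)
      then have "\<bar>n * ?D * (x \<bullet> i) - n * ?D * (t \<bullet> i)\<bar> \<le> 1" if "i \<in> Basis" for i
        using that floor_diff_le by blast
      moreover have "\<bar>n * ?D * (x \<bullet> i) - n * ?D * (t \<bullet> i)\<bar> = \<bar>(x - t) \<bullet> i\<bar> * (n * ?D)" for i
        by (simp add: inner_diff_left abs_mult flip: right_diff_distrib)
      ultimately have "\<bar>(x - t) \<bullet> i\<bar> \<le> 1 / (n * ?D)" if "i \<in> Basis" for i
        using that n D by (simp only: pos_le_divide_eq mult_pos_pos of_nat_0_less_iff DIM_positive)
      then have "norm (x - t) \<le> (\<Sum>i\<in>(Basis::'a set). 1 / (n * ?D))"
        by (intro order.trans[OF norm_le_l1] sum_mono) auto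
      then show "dist x t \<le> 1 / real n" by (simp add: dist_norm)
    qed
    ultimately show "\<exists>T\<subseteq>S. finite T \<and> real (card T) \<le> (2 * ?D * B + 3) ^ DIM('a) * real n ^ DIM('a) \<and>
       (\<forall>x\<in>S. \<exists>t\<in>T. dist x t \<le> 1 / real n)"
      using TS gS by (intro exI[of _ T]) (auto simp: T_def)
  qed
qed

text \<open>There are k + 1 possible lengths, and \<open>1 \<le> N\<close> lets the count for each
  be bounded by that for the longest.\<close>

lemma card_lists_length_le_bound:
  assumes "finite T" "real (card T) \<le> N" "1 \<le> N"
  shows "real (card {qs. set qs \<subseteq> T \<and> length qs \<le> k}) \<le> (real k + 1) * N ^ k"
proof -
  have "real (card {qs. set qs \<subseteq> T \<and> length qs \<le> k}) = (\<Sum>i\<le>k. real (card T) ^ i)"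
    using assms by (simp add: card_lists_length_le)
  also have "\<dots> \<le> (\<Sum>i\<le>k. N ^ k)"
    using assms by (intro sum_mono order.trans[OF power_mono power_increasing]) auto
  finally show ?thesis
    by (simp add: add.commute)
qed

section \<open>Hellinger affinity and likelihood ratios\<close>

text \<open>With \<rho> the affinity and \<open>A\<close> the L1 distance, integrating a pointwise
  quadratic inequality and using \<open>\<rho> \<le> 1\<close> gives \<rho> \<le> 1 - A^2 / 8. The
  exponential form is convenient because the n-th power is taken later.\<close>

lemma affinity_le_exp:
  fixes p q :: "'a \<Rightarrow> real"
  assumes p: "integrable N p" "\<And>z. 0 \<le> p z" "(\<integral>z. p z \<partial>N) = 1"
    and q: "integrable N q" "\<And>z. 0 \<le> q z" "(\<integral>z. q z \<partial>N) = 1"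
  shows "integrable N (\<lambda>z. sqrt (p z * q z))"
    and "(\<integral>z. sqrt (p z * q z) \<partial>N) \<le> exp (- (\<integral>z. \<bar>p z - q z\<bar> \<partial>N)\<^sup>2 / 8)"
proof -
  have [measurable]: "p \<in> borel_measurable N" "q \<in> borel_measurable N"
    using p q by (auto simp: borel_measurable_integrable)
  have gm: "sqrt (p z * q z) \<le> (p z + q z) / 2" for z
    using p(2)[of z] q(2)[of z] by (intro arith_geo_mean_sqrt) auto
  show int: "integrable N (\<lambda>z. sqrt (p z * q z))"
  proof (rule Bochner_Integration.integrable_bound)
    show "integrable N (\<lambda>z. (p z + q z) / 2)" using p q by auto
    show "AE z in N. norm (sqrt (p z * q z)) \<le> norm ((p z + q z) / 2)"
      using gm p(2) q(2) by (auto simp: abs_mult)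
  qed measurable
  define A \<rho> where "A = (\<integral>z. \<bar>p z - q z\<bar> \<partial>N)" and "\<rho> = (\<integral>z. sqrt (p z * q z) \<partial>N)"
  have "\<rho> \<le> (\<integral>z. (p z + q z) / 2 \<partial>N)"
    unfolding \<rho>_def using p q int gm by (intro integral_mono) auto
  then have \<rho>: "\<rho> \<le> 1" using p q by simp
  have pw: "2 * t * \<bar>p z - q z\<bar> \<le> (p z + q z - 2 * sqrt (p z * q z)) + t\<^sup>2 * (p z + q z + 2 * sqrt (p z * q z))"
    for t z
  proof -
    \<comment> \<open>With \<open>u\<close> and \<open>v\<close> as below this is \<open>2 t u v \<le> u\<^sup>2 + t\<^sup>2 v\<^sup>2\<close>; the choice \<open>t = A / 4\<close> replaces Cauchy-Schwarz.\<close>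
    let ?u = "\<bar>sqrt (p z) - sqrt (q z)\<bar>" and ?v = "sqrt (p z) + sqrt (q z)"
    have "p z - q z = (sqrt (p z) - sqrt (q z)) * ?v"
      using p(2)[of z] q(2)[of z] by (simp add: algebra_simps)
    then have "\<bar>p z - q z\<bar> = ?u * ?v"
      using p(2)[of z] q(2)[of z] by (simp add: abs_mult)
    moreover have "0 \<le> (?u - t * ?v)\<^sup>2" by simp
    moreover have "?u\<^sup>2 = p z + q z - 2 * sqrt (p z * q z)" "?v\<^sup>2 = p z + q z + 2 * sqrt (p z * q z)"
      using p(2)[of z] q(2)[of z] by (simp_all add: power2_diff power2_sum real_sqrt_mult)
    ultimately show ?thesis by (simp add: power2_diff power_mult_distrib mult_ac)
  qed
  have "(\<integral>z. 2 * (A / 4) * \<bar>p z - q z\<bar> \<partial>N) \<le>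
      (\<integral>z. (p z + q z - 2 * sqrt (p z * q z)) + (A / 4)\<^sup>2 * (p z + q z + 2 * sqrt (p z * q z)) \<partial>N)"
    using p q int by (intro integral_mono pw) auto
  then have "2 * (A / 4) * A \<le> (2 - 2 * \<rho>) + (A / 4)\<^sup>2 * (2 + 2 * \<rho>)"
    using p q int by (simp add: A_def[symmetric] \<rho>_def[symmetric])
  also have "\<dots> \<le> (2 - 2 * \<rho>) + (A / 4)\<^sup>2 * 4"
    using \<rho> by (intro add_left_mono mult_left_mono) auto
  finally have "\<rho> \<le> 1 + - A\<^sup>2 / 8" by (simp add: power2_eq_square)
  also have "\<dots> \<le> exp (- A\<^sup>2 / 8)" by (rule exp_ge_add_one_self)
  finally show "\<rho> \<le> exp (- A\<^sup>2 / 8)" .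
qed

text \<open>A one-sided bound suffices for L1 closeness because both functions integrate to 1:
  \<open>e * g - f\<close> is nonnegative almost everywhere with integral \<open>e - 1\<close>, and
  so is \<open>(e - 1) * g\<close>. Together they bound the distance of \<open>f\<close> and
  \<open>g\<close>, and the triangle inequality does the rest.\<close>

lemma integral_abs_diff_le_bracket:
  fixes f g h :: "'a \<Rightarrow> real"
  assumes f: "integrable N f" "(\<integral>z. f z \<partial>N) = 1"
    and g: "integrable N g" "(\<integral>z. g z \<partial>N) = 1" "\<And>z. 0 \<le> g z"
    and h: "integrable N h"
    and le: "AE z in N. f z \<le> e * g z" and "1 \<le> e"
  shows "(\<integral>z. \<bar>f z - h z\<bar> \<partial>N) \<le> 2 * (e - 1) + (\<integral>z. \<bar>g z - h z\<bar> \<partial>N)"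
proof -
  have "(\<integral>z. \<bar>f z - h z\<bar> \<partial>N) \<le> (\<integral>z. (e * g z - f z) + (e - 1) * g z + \<bar>g z - h z\<bar> \<partial>N)"
  proof (rule integral_mono_AE)
    show "AE z in N. \<bar>f z - h z\<bar> \<le> (e * g z - f z) + (e - 1) * g z + \<bar>g z - h z\<bar>"
      using le
    proof eventually_elim
      case (elim z)
      have "g z \<le> e * g z" using mult_right_mono[OF \<open>1 \<le> e\<close> g(3)] by simp
      with elim show ?case by (simp add: algebra_simps)
    qed
  qed (use f g h in auto)
  also have "\<dots> = 2 * (e - 1) + (\<integral>z. \<bar>g z - h z\<bar> \<partial>N)"
    using f g h by simp
  finally show ?thesis .
qed

text \<open>This is a Chernoff bound with exponent 1/2: independence factors the expected square
  root of the likelihood ratio into n equal affinities, and the same root turns \<open>exp c\<close>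
  into \<open>exp (c / 2)\<close>.\<close>

lemma (in prob_space) likelihood_ratio_tail:
  fixes p q :: "'b \<Rightarrow> real"
  assumes indep: "indep_vars (\<lambda>_. S) Z {..<n}"
    and distr: "\<And>i. i < n \<Longrightarrow> distr M S (Z i) = density N (\<lambda>z. ennreal (p z))"
    and sets: "sets N = sets S"
    and p: "integrable N p" "\<And>z. 0 < p z" "(\<integral>z. p z \<partial>N) = 1"
    and q: "integrable N q" "\<And>z. 0 \<le> q z" "(\<integral>z. q z \<partial>N) = 1"
  shows "{\<omega> \<in> space M. (\<Prod>i<n. p (Z i \<omega>)) \<le> exp c * (\<Prod>i<n. q (Z i \<omega>))} \<in> events"
    and "emeasure M {\<omega> \<in> space M. (\<Prod>i<n. p (Z i \<omega>)) \<le> exp c * (\<Prod>i<n. q (Z i \<omega>))}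
      \<le> ennreal (exp (c / 2 - real n * (\<integral>z. \<bar>p z - q z\<bar> \<partial>N)\<^sup>2 / 8))"
proof -
  have [measurable]: "p \<in> borel_measurable S" "q \<in> borel_measurable S"
    using p q sets by (auto simp: borel_measurable_integrable cong: measurable_cong_sets
        dest!: borel_measurable_integrable)
  have Z[measurable]: "i < n \<Longrightarrow> Z i \<in> measurable M S" for i
    using indep by (auto simp: indep_vars_def)
  let ?E = "{\<omega> \<in> space M. (\<Prod>i<n. p (Z i \<omega>)) \<le> exp c * (\<Prod>i<n. q (Z i \<omega>))}"
  show "?E \<in> events"
    by measurable
  define r where "r = (\<lambda>z. sqrt (q z / p z))"
  have [measurable]: "r \<in> borel_measurable S" by (simp add: r_def)
  have r0: "0 \<le> r z" for z using p(2)[of z] q(2)[of z] by (simp add: r_def)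
  define \<rho> where "\<rho> = (\<integral>z. sqrt (p z * q z) \<partial>N)"
  have p0: "0 \<le> p z" for z using p(2)[of z] by simp
  note aff = affinity_le_exp[OF p(1) p0 p(3) q]
  \<comment> \<open>\<open>Z i\<close> has density \<open>p\<close>, so the mean of
    \<open>sqrt (q / p)\<close> is the integral of \<open>p * sqrt (q / p)\<close>, that is, of
    \<open>sqrt (p * q)\<close>.\<close>
  have mean: "(\<integral>\<^sup>+\<omega>. ennreal (r (Z i \<omega>)) \<partial>M) = ennreal \<rho>" if "i < n" for i
  proof -
    have "(\<integral>\<^sup>+\<omega>. ennreal (r (Z i \<omega>)) \<partial>M) = (\<integral>\<^sup>+z. ennreal (r z) \<partial>distr M S (Z i))"
      using that by (subst nn_integral_distr) auto
    also have "\<dots> = (\<integral>\<^sup>+z. ennreal (p z) * ennreal (r z) \<partial>N)"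
      unfolding distr[OF that] by (subst nn_integral_density) (auto cong: measurable_cong_sets simp: sets)
    also have "\<dots> = (\<integral>\<^sup>+z. ennreal (sqrt (p z * q z)) \<partial>N)"
    proof (intro nn_integral_cong)
      fix z
      have "p z * r z = sqrt ((p z)\<^sup>2 * (q z / p z))"
        using p0[of z] by (simp only: r_def real_sqrt_mult real_sqrt_abs abs_of_nonneg)
      also have "(p z)\<^sup>2 * (q z / p z) = p z * q z"
        using p(2)[of z] by (simp add: power2_eq_square)
      finally show "ennreal (p z) * ennreal (r z) = ennreal (sqrt (p z * q z))"
        using p0 r0 by (simp flip: ennreal_mult)
    qed
    also have "\<dots> = ennreal \<rho>"
      unfolding \<rho>_def using p0 q by (intro nn_integral_eq_integral aff) auto
    finally show ?thesis .
  qed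
  have "?E \<subseteq> {\<omega> \<in> space M. 1 \<le> ennreal (exp (c / 2)) * (\<Prod>i<n. ennreal (r (Z i \<omega>)))}"
  proof safe
    have sqrt_prod: "sqrt (\<Prod>i<m. f i) = (\<Prod>i<m. sqrt (f i))" for m and f :: "nat \<Rightarrow> real"
      by (induction m) (simp_all add: real_sqrt_mult)
    fix \<omega> assume \<omega>: "(\<Prod>i<n. p (Z i \<omega>)) \<le> exp c * (\<Prod>i<n. q (Z i \<omega>))"
    have "0 < (\<Prod>i<n. p (Z i \<omega>))" using p(2) by (intro prod_pos) auto
    with \<omega> have "1 \<le> exp c * (\<Prod>i<n. q (Z i \<omega>) / p (Z i \<omega>))"
      by (simp add: prod_dividef field_simps)
    then have "1 \<le> sqrt (exp c * (\<Prod>i<n. q (Z i \<omega>) / p (Z i \<omega>)))" by simp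
    also have "\<dots> = sqrt (exp c) * (\<Prod>i<n. r (Z i \<omega>))"
      by (simp add: real_sqrt_mult r_def sqrt_prod)
    also have "sqrt (exp c) = exp (c / 2)"
      by (intro real_sqrt_unique) (simp_all flip: exp_of_nat_mult)
    finally have "ennreal 1 \<le> ennreal (exp (c / 2) * (\<Prod>i<n. r (Z i \<omega>)))" by (rule ennreal_leI)
    then show "1 \<le> ennreal (exp (c / 2)) * (\<Prod>i<n. ennreal (r (Z i \<omega>)))"
      using r0 by (simp add: ennreal_mult prod_nonneg prod_ennreal)
  qed
  then have "emeasure M ?E \<le> emeasure M {\<omega> \<in> space M. 1 \<le> ennreal (exp (c / 2)) * (\<Prod>i<n. ennreal (r (Z i \<omega>)))}"
    by (intro emeasure_mono) measurable
  also have "\<dots> \<le> ennreal (exp (c / 2)) * (\<integral>\<^sup>+\<omega>. (\<Prod>i<n. ennreal (r (Z i \<omega>))) * indicator (space M) \<omega> \<partial>M)"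
    by (intro nn_integral_Markov_inequality) auto
  also have "(\<integral>\<^sup>+\<omega>. (\<Prod>i<n. ennreal (r (Z i \<omega>))) * indicator (space M) \<omega> \<partial>M) = (\<integral>\<^sup>+\<omega>. (\<Prod>i<n. ennreal (r (Z i \<omega>))) \<partial>M)"
    by (intro nn_integral_cong) simp
  also have "\<dots> = (\<Prod>i<n. \<integral>\<^sup>+\<omega>. ennreal (r (Z i \<omega>)) \<partial>M)"
    by (intro indep_vars_nn_integral indep_vars_compose2[OF indep]) auto
  also have "\<dots> = ennreal \<rho> ^ n"
    by (simp add: mean)
  also have "\<dots> \<le> ennreal (exp (- (\<integral>z. \<bar>p z - q z\<bar> \<partial>N)\<^sup>2 / 8)) ^ n"
    unfolding \<rho>_def by (intro power_mono ennreal_leI aff) auto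
  also have "ennreal (exp (c / 2)) * \<dots> = ennreal (exp (c / 2 - real n * (\<integral>z. \<bar>p z - q z\<bar> \<partial>N)\<^sup>2 / 8))"
    by (simp add: ennreal_power flip: ennreal_mult exp_of_nat_mult exp_add)
  finally show "emeasure M ?E \<le> ennreal (exp (c / 2 - real n * (\<integral>z. \<bar>p z - q z\<bar> \<partial>N)\<^sup>2 / 8))"
    by (simp add: mult_left_mono)
qed

section \<open>The joint law of covariate and response\<close>

lemma moe_density_measurable [measurable]:
  fixes ps :: "'v::euclidean_space component list"
  shows "(\<lambda>z. moe_density ps (fst z) (snd z)) \<in> borel_measurable (borel \<Otimes>\<^sub>M borel)"
  unfolding moe_density_def softmax_def gate_score_def expert_density_def normal_density_def case_prod_beta
  by measurable

lemma has_bochner_integral_moe_density: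
  assumes "1 \<le> length ps" "\<And>\<theta>. \<theta> \<in> set ps \<Longrightarrow> 0 < variance_of \<theta>"
  shows "has_bochner_integral lborel (moe_density ps x) 1"
proof -
  have pos: "0 < variance_of (ps ! i)" if "i < length ps" for i using assms(2) that by simp
  have "has_bochner_integral lborel (moe_density ps x)
     (\<Sum>i<length ps. softmax (length ps) (\<lambda>j. gate_score (ps ! j) x) i * 1)"
    unfolding moe_density_def
  proof (intro has_bochner_integral_sum has_bochner_integral_mult_right)
    fix i assume "i \<in> {..<length ps}"
    then show "has_bochner_integral lborel (expert_density (ps ! i) x) 1"
      using pos by (simp add: expert_density_def case_prod_beta has_bochner_integral_iff)
  qed
  then show ?thesis using assms(1) by (simp add: sum_softmax)
qed

text \<open>Over the product of the covariate law with Lebesgue measure, a conditional density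
  becomes an ordinary density of one observation, so the results on affinity apply to it.\<close>

locale covariate_law = prob_space PX for PX :: "'v::euclidean_space measure" +
  assumes sets_PX [measurable_cong]: "sets PX = sets borel"
begin

sublocale pair_sigma_finite PX lborel ..

abbreviation joint :: "('v \<times> real) measure" where
  "joint \<equiv> PX \<Otimes>\<^sub>M lborel"

lemma sets_joint: "sets joint = sets (borel \<Otimes>\<^sub>M borel)"
  by (intro sets_pair_measure_cong sets_PX sets_lborel)

lemma moe_density_joint:
  assumes "1 \<le> length ps" "\<And>\<theta>. \<theta> \<in> set ps \<Longrightarrow> 0 < variance_of \<theta>"
  shows "integrable joint (\<lambda>z. moe_density ps (fst z) (snd z))"
    and "(\<integral>z. moe_density ps (fst z) (snd z) \<partial>joint) = 1"
proof -
  note hbi = has_bochner_integral_moe_density[OF assms]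
  have int: "integrable lborel (moe_density ps x)" "integral\<^sup>L lborel (moe_density ps x) = 1" for x
    using hbi by (auto simp: has_bochner_integral_iff)
  show I: "integrable joint (\<lambda>z. moe_density ps (fst z) (snd z))"
  proof (rule Fubini_integrable)
    show "integrable PX (\<lambda>x. \<integral>y. norm (moe_density ps (fst (x, y)) (snd (x, y))) \<partial>lborel)"
      by (simp add: moe_density_nonneg int)
  qed (simp_all add: int)
  show "(\<integral>z. moe_density ps (fst z) (snd z) \<partial>joint) = 1"
    using integral_fst'[OF I] by (simp add: int prob_space)
qed

text \<open>By Fubini, the expected total variation distance is half an L1 distance of joint
  densities, the distance controlled by \<open>likelihood_ratio_tail\<close>.\<close>

lemma integral_tv_dist:
  assumes "integrable joint (\<lambda>z. f (fst z) (snd z))" "integrable joint (\<lambda>z. g (fst z) (snd z))"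
  shows "(\<integral>x. tv_dist (f x) (g x) \<partial>PX) = 1 / 2 * (\<integral>z. \<bar>f (fst z) (snd z) - g (fst z) (snd z)\<bar> \<partial>joint)"
proof -
  have "integrable joint (\<lambda>z. \<bar>f (fst z) (snd z) - g (fst z) (snd z)\<bar>)"
    using assms by auto
  from integral_fst'[OF this] show ?thesis by (simp add: tv_dist_def)
qed

lemma AE_joint_norm_le:
  assumes "AE x in PX. norm x \<le> R"
  shows "AE z in joint. norm (fst z) \<le> R"
proof (rule AE_pair_measure)
  show "{z \<in> space joint. norm (fst z) \<le> R} \<in> sets joint" by measurable
  show "AE x in PX. AE y in lborel. norm (fst (x, y)) \<le> R"
    using assms by eventually_elim simp
qed

text \<open>Each observation has a density with respect to \<open>joint\<close>, so null sets of the
  covariate law stay null for the sample.\<close>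

lemma AE_sample_norm_le:
  assumes iid: "iid_sample M PX p n X Y" and "i < n"
    and p: "(\<lambda>z. p (fst z) (snd z)) \<in> borel_measurable joint"
    and R: "AE x in PX. norm x \<le> R"
  shows "AE \<omega> in M. norm (X i \<omega>) \<le> R"
proof -
  let ?Z = "\<lambda>\<omega>. (X i \<omega>, Y i \<omega>)"
  have Z: "?Z \<in> measurable M (borel \<Otimes>\<^sub>M borel)"
    using iid \<open>i < n\<close> by (auto simp: iid_sample_def prob_space.indep_vars_def)
  have "distr M (borel \<Otimes>\<^sub>M borel) ?Z = density joint (\<lambda>z. ennreal (p (fst z) (snd z)))"
    using iid \<open>i < n\<close> by (simp add: iid_sample_def case_prod_unfold)
  moreover have "AE z in density joint (\<lambda>z. ennreal (p (fst z) (snd z))). norm (fst z) \<le> R"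
    using AE_joint_norm_le[OF R] p by (subst AE_density) auto
  ultimately have "AE z in distr M (borel \<Otimes>\<^sub>M borel) ?Z. norm (fst z) \<le> R" by (simp only:)
  from AE_distrD[OF Z this] show ?thesis by simp
qed

end

section \<open>Tail bound for the maximum likelihood estimator\<close>

text \<open>This is \<open>1 - exp (- s) \<le> s\<close> scaled by \<open>exp s\<close>; it will
  bound the bracketing error by a multiple of 1/n.\<close>

lemma exp_diff_one_le: "exp s - 1 \<le> s * exp (s::real)"
proof -
  have "(1 - exp (- s)) * exp s \<le> s * exp s"
    using exp_ge_add_one_self[of "- s"] by (intro mult_right_mono) auto
  then show ?thesis by (simp add: left_diff_distrib mult_exp_exp)
qed

text \<open>The maximum is over measures, the estimates are about lists. The list witnessing that
  the true measure is a candidate may differ from \<open>pstar\<close>, but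
  \<open>moe_density_cong\<close> identifies the densities. Positivity allows the logarithms to be
  exponentiated away.\<close>

lemma is_mle_prod_le:
  assumes mle: "is_mle k \<Theta> n x y G" and "mixing_measure pstar \<in> mixing_measures k \<Theta>" and "1 \<le> n"
    and pos: "\<And>\<theta>. \<theta> \<in> \<Theta> \<Longrightarrow> 0 < variance_of \<theta>"
  obtains ps where "G = mixing_measure ps" "1 \<le> length ps" "length ps \<le> k" "set ps \<subseteq> \<Theta>"
    "(\<Prod>i<n. moe_density pstar (x i) (y i)) \<le> (\<Prod>i<n. moe_density ps (x i) (y i))"
proof -
  obtain ps where ps: "G = mixing_measure ps" "1 \<le> length ps" "length ps \<le> k" "set ps \<subseteq> \<Theta>"
    using mle by (auto simp: is_mle_def is_arg_max_def mixing_measures_def)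
  obtain ps' where ps': "mixing_measure pstar = mixing_measure ps'" "1 \<le> length ps'" "set ps' \<subseteq> \<Theta>"
    using assms(2) by (auto simp: mixing_measures_def)
  have "avg_log_lik n x y (mixing_measure ps') \<le> avg_log_lik n x y G"
    using mle assms(2) ps'(1) by (force simp: is_mle_def is_arg_max_linorder)
  then have le: "(\<Sum>i<n. ln (moe_density ps' (x i) (y i))) \<le> (\<Sum>i<n. ln (moe_density ps (x i) (y i)))"
    using \<open>1 \<le> n\<close> by (simp add: avg_log_lik_def ps cond_density_mixing_measure divide_le_cancel)
  have exp_sum_ln: "exp (\<Sum>i<n. ln (moe_density qs (x i) (y i))) = (\<Prod>i<n. moe_density qs (x i) (y i))"
    if "1 \<le> length qs" "set qs \<subseteq> \<Theta>" for qs
  proof -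
    have "0 < moe_density qs (x i) (y i)" for i
      using that pos by (intro moe_density_pos) auto
    then show ?thesis by (simp add: exp_sum)
  qed
  have "(\<Prod>i<n. moe_density ps' (x i) (y i)) \<le> (\<Prod>i<n. moe_density ps (x i) (y i))"
    using le ps ps' by (simp flip: exp_sum_ln)
  then have "(\<Prod>i<n. moe_density pstar (x i) (y i)) \<le> (\<Prod>i<n. moe_density ps (x i) (y i))"
    using moe_density_cong[OF ps'(1)] by simp
  with ps show thesis by (rule that)
qed

text \<open>A union bound over lists from the net. In the threshold, \<open>A / 2\<close> reflects
  the factor 1/2 of total variation, and \<open>exp (c / real n) - 1\<close> is the price of
  replacing the estimator by its net neighbour. \<open>Ghat\<close> is an arbitrary function, so the
  bad set need not be measurable and is bounded in outer measure.\<close>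

lemma (in covariate_law) mle_tail_bound:
  fixes \<Theta> T :: "'v component set" and pstar :: "'v component list" and R \<nu>0 A :: real
  defines "c \<equiv> 4 + 3 / (2 * \<nu>0) + (R + 1)\<^sup>2 / 2"
  assumes \<nu>0: "0 < \<nu>0" "\<And>\<theta>. \<theta> \<in> \<Theta> \<Longrightarrow> \<nu>0 \<le> variance_of \<theta>"
    and pstar: "mixing_measure pstar \<in> mixing_measures k \<Theta>" "1 \<le> length pstar" "set pstar \<subseteq> \<Theta>"
    and R: "AE x in PX. norm x \<le> R"
    and n: "1 \<le> n"
    and T: "T \<subseteq> \<Theta>" "finite T" "\<And>\<theta>. \<theta> \<in> \<Theta> \<Longrightarrow> \<exists>t\<in>T. dist \<theta> t \<le> 1 / real n"
    and card: "real (card {qs. set qs \<subseteq> T \<and> length qs \<le> k}) \<le> N"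
    and "0 \<le> A"
    and iid: "iid_sample M PX (cond_density (mixing_measure pstar)) n X Y"
    and mle: "\<And>\<omega>. \<omega> \<in> space M \<Longrightarrow> is_mle k \<Theta> n (\<lambda>i. X i \<omega>) (\<lambda>i. Y i \<omega>) (Ghat \<omega>)"
  shows "outer_measure_of M {\<omega> \<in> space M.
      (\<integral>x. tv_dist (cond_density (Ghat \<omega>) x) (cond_density (mixing_measure pstar) x) \<partial>PX)
        > A / 2 + (exp (c / real n) - 1)}
    \<le> ennreal (N * exp (c / 2 - real n * A\<^sup>2 / 8))"
    (is "outer_measure_of M ?bad \<le> _")
proof -
  interpret M: prob_space M using iid by (simp add: iid_sample_def)
  have c0: "0 \<le> c" using \<nu>0(1) by (simp add: c_def)
  have pos: "0 < variance_of \<theta>" if "\<theta> \<in> \<Theta>" for \<theta>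
    using \<nu>0(1) \<nu>0(2)[OF that] by (rule less_le_trans)
  define p where "p = (\<lambda>z. moe_density pstar (fst z) (snd z))"
  define Z where "Z = (\<lambda>i \<omega>. (X i \<omega>, Y i \<omega>))"
  \<comment> \<open>Mesh 1/n calls for inflation by 2/n; the n bracketing factors
    \<open>exp (c / real n)\<close> then multiply to \<open>exp c\<close>, whatever n is.\<close>
  define blow where "blow = map (inflate (2 * (1 / real n)) :: 'v component \<Rightarrow> _)"
  define g where "g = (\<lambda>qs z. moe_density (blow qs) (fst z) (snd z))"
  define E where "E = (\<lambda>qs. {\<omega> \<in> space M. (\<Prod>i<n. p (Z i \<omega>)) \<le> exp c * (\<Prod>i<n. g qs (Z i \<omega>))})"
  \<comment> \<open>Only lists far from the truth enter, since only for them is \<open>E\<close>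
    improbable. Nonemptiness makes the mixture a probability density.\<close>
  define Q where "Q = {qs. set qs \<subseteq> T \<and> length qs \<le> k \<and> 1 \<le> length qs \<and> A \<le> (\<integral>z. \<bar>p z - g qs z\<bar> \<partial>joint)}"
  have p: "integrable joint p" "(\<integral>z. p z \<partial>joint) = 1" "\<And>z. 0 < p z"
    unfolding p_def using pstar pos by (auto intro!: moe_density_joint moe_density_pos)
  have blow: "1 \<le> length (blow qs)" "\<And>\<theta>. \<theta> \<in> set (blow qs) \<Longrightarrow> 0 < variance_of \<theta>"
    if "set qs \<subseteq> T" "1 \<le> length qs" for qs
  proof -
    show "1 \<le> length (blow qs)" using that by (simp add: blow_def)
    fix \<theta> assume "\<theta> \<in> set (blow qs)"
    then obtain \<theta>' where "\<theta> = inflate (2 * (1 / real n)) \<theta>'" "\<theta>' \<in> set qs"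
      unfolding blow_def set_map by (rule imageE)
    moreover from this that T(1) have "0 < variance_of \<theta>'" by (intro pos) blast
    ultimately show "0 < variance_of \<theta>" using n by (simp add: add_pos_pos)
  qed
  have g: "integrable joint (g qs)" "(\<integral>z. g qs z \<partial>joint) = 1"
    if "set qs \<subseteq> T" "1 \<le> length qs" for qs
    unfolding g_def using moe_density_joint[OF blow[OF that]] by auto
  have g0: "0 \<le> g qs z" for qs z by (simp add: g_def moe_density_nonneg)
  have Z: "M.indep_vars (\<lambda>_. borel \<Otimes>\<^sub>M borel) Z {..<n}"
    "\<And>i. i < n \<Longrightarrow> distr M (borel \<Otimes>\<^sub>M borel) (Z i) = density joint (\<lambda>z. ennreal (p z))"
    using iid by (auto simp: iid_sample_def Z_def p_def cond_density_mixing_measure case_prod_unfold)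
  have E: "E qs \<in> sets M" "emeasure M (E qs) \<le> ennreal (exp (c / 2 - real n * A\<^sup>2 / 8))" if "qs \<in> Q" for qs
  proof -
    have qs: "set qs \<subseteq> T" "1 \<le> length qs" "A \<le> (\<integral>z. \<bar>p z - g qs z\<bar> \<partial>joint)"
      using that by (auto simp: Q_def)
    note tail = M.likelihood_ratio_tail[OF Z sets_joint p(1,3,2) g(1)[OF qs(1,2)] g0 g(2)[OF qs(1,2)], of c]
    show "E qs \<in> sets M" unfolding E_def by (rule tail)
    have "A\<^sup>2 \<le> (\<integral>z. \<bar>p z - g qs z\<bar> \<partial>joint)\<^sup>2"
      using qs(3) \<open>0 \<le> A\<close> by (rule power_mono)
    then have "real n * A\<^sup>2 / 8 \<le> real n * (\<integral>z. \<bar>p z - g qs z\<bar> \<partial>joint)\<^sup>2 / 8"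
      by (intro divide_right_mono mult_left_mono) auto
    then show "emeasure M (E qs) \<le> ennreal (exp (c / 2 - real n * A\<^sup>2 / 8))"
      unfolding E_def
      by (intro order.trans[OF tail(2)] ennreal_leI iffD2[OF exp_le_cancel_iff] diff_left_mono)
  qed
  \<comment> \<open>The bracket holds only for covariates of norm at most \<open>R\<close>; samples
    violating this go into the null set \<open>N0\<close>.\<close>
  have "AE \<omega> in M. \<forall>i\<in>{..<n}. norm (X i \<omega>) \<le> R"
    using AE_sample_norm_le[OF iid _ _ R] p(1)
    by (intro AE_finite_allI) (auto simp: p_def cond_density_mixing_measure)
  then obtain N0 where N0: "{\<omega> \<in> space M. \<not> (\<forall>i\<in>{..<n}. norm (X i \<omega>) \<le> R)} \<subseteq> N0"
    "emeasure M N0 = 0" "N0 \<in> sets M" by (rule AE_E)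
  have fin: "finite {qs. set qs \<subseteq> T \<and> length qs \<le> k}"
    by (rule finite_lists_length_le[OF T(2)])
  have QT: "Q \<subseteq> {qs. set qs \<subseteq> T \<and> length qs \<le> k}" by (auto simp: Q_def)
  have finQ: "finite Q" using fin QT by (rule rev_finite_subset)
  have cardQ: "real (card Q) \<le> N" using card_mono[OF fin QT] card by linarith
  \<comment> \<open>Outside \<open>N0\<close>, the componentwise rounding \<open>qs\<close> of the
    estimator to the net is the witness: it inherits both the large likelihood and, up to the
    bracketing error, the distance from the truth.\<close>
  have "?bad \<subseteq> N0 \<union> (\<Union>qs\<in>Q. E qs)"
  proof (rule subsetI)
    fix \<omega> assume bad: "\<omega> \<in> ?bad"
    show "\<omega> \<in> N0 \<union> (\<Union>qs\<in>Q. E qs)"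
    proof (cases "\<forall>i<n. norm (X i \<omega>) \<le> R")
      case False
      then show ?thesis using N0(1) bad by auto
    next
      case True
      have "is_mle k \<Theta> n (\<lambda>i. X i \<omega>) (\<lambda>i. Y i \<omega>) (Ghat \<omega>)" using mle bad by simp
      from is_mle_prod_le[OF this pstar(1) n pos] obtain ps where ps: "Ghat \<omega> = mixing_measure ps"
        "1 \<le> length ps" "length ps \<le> k" "set ps \<subseteq> \<Theta>"
        "(\<Prod>i<n. p (Z i \<omega>)) \<le> (\<Prod>i<n. moe_density ps (X i \<omega>) (Y i \<omega>))"
        by (auto simp: p_def Z_def)
      obtain t where t: "\<And>\<theta>. \<theta> \<in> \<Theta> \<Longrightarrow> t \<theta> \<in> T \<and> dist \<theta> (t \<theta>) \<le> 1 / real n"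
        using T(3) by metis
      define qs where "qs = map t ps"
      have qs: "set qs \<subseteq> T" "length qs = length ps" "1 \<le> length qs" "length qs \<le> k"
        using ps t by (auto simp: qs_def)
      have bracket: "moe_density ps x y \<le> exp (c / real n) * g qs (x, y)" if "norm x \<le> R" for x y
      proof -
        have "moe_density ps x y \<le> exp (c * (1 / real n)) * moe_density (map (inflate (2 * (1 / real n))) qs) x y"
          unfolding c_def
        proof (rule moe_density_le_inflated[OF qs(2)[symmetric] _ \<nu>0(1) _ _ that])
          fix i assume "i < length ps"
          then have "ps ! i \<in> \<Theta>" "qs ! i = t (ps ! i)" using ps(4) by (auto simp: qs_def)
          then show "dist (ps ! i) (qs ! i) \<le> 1 / real n" using t by simp
        next
          fix \<theta> assume "\<theta> \<in> set ps"
          then show "\<nu>0 \<le> variance_of \<theta>" using ps(4) by (intro \<nu>0(2)) auto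
        qed (use n in simp)
        then show ?thesis by (simp add: g_def blow_def)
      qed
      have "(\<Prod>i<n. moe_density ps (X i \<omega>) (Y i \<omega>)) \<le> (\<Prod>i<n. exp (c / real n) * g qs (Z i \<omega>))"
        using True by (intro prod_mono) (auto simp: Z_def moe_density_nonneg intro!: bracket)
      also have "\<dots> = exp c * (\<Prod>i<n. g qs (Z i \<omega>))"
        using n by (simp add: prod.distrib flip: exp_of_nat_mult)
      finally have "\<omega> \<in> E qs" using ps(5) bad by (simp add: E_def)
      \<comment> \<open>Passing from \<open>ps\<close> to the inflated \<open>qs\<close> costs at
        most \<open>2 * (exp (c / real n) - 1)\<close> in L1; halved, this is exactly the excess of
        the threshold over \<open>A / 2\<close>.\<close>
      moreover have "qs \<in> Q"
      proof -
        have f: "integrable joint (\<lambda>z. moe_density ps (fst z) (snd z))" "(\<integral>z. moe_density ps (fst z) (snd z) \<partial>joint) = 1"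
          using ps pos by (auto intro!: moe_density_joint)
        have "AE z in joint. moe_density ps (fst z) (snd z) \<le> exp (c / real n) * g qs z"
          using AE_joint_norm_le[OF R]
        proof eventually_elim
          case (elim z)
          from bracket[OF elim, of "snd z"] show ?case by simp
        qed
        from integral_abs_diff_le_bracket[OF f g[OF qs(1,3)] g0 p(1) this] c0
        have "(\<integral>z. \<bar>moe_density ps (fst z) (snd z) - p z\<bar> \<partial>joint)
            \<le> 2 * (exp (c / real n) - 1) + (\<integral>z. \<bar>p z - g qs z\<bar> \<partial>joint)"
          by (simp add: abs_minus_commute)
        moreover have "(\<integral>x. tv_dist (moe_density ps x) (moe_density pstar x) \<partial>PX)
            = 1 / 2 * (\<integral>z. \<bar>moe_density ps (fst z) (snd z) - p z\<bar> \<partial>joint)"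
          using f(1) p(1) unfolding p_def by (rule integral_tv_dist)
        ultimately have "A \<le> (\<integral>z. \<bar>p z - g qs z\<bar> \<partial>joint)"
          using bad by (simp add: ps(1) cond_density_mixing_measure)
        then show ?thesis using qs by (simp add: Q_def)
      qed
      ultimately show ?thesis by blast
    qed
  qed
  then have "outer_measure_of M ?bad \<le> outer_measure_of M (N0 \<union> (\<Union>qs\<in>Q. E qs))"
    by (rule outer_measure_of_mono)
  also have "\<dots> = emeasure M (N0 \<union> (\<Union>qs\<in>Q. E qs))"
    by (intro outer_measure_of_eq sets.Un N0 sets.finite_UN finQ E)
  also have "\<dots> \<le> emeasure M N0 + emeasure M (\<Union>qs\<in>Q. E qs)"
    by (intro emeasure_subadditive N0 sets.finite_UN finQ E)
  also have "\<dots> = emeasure M (\<Union>qs\<in>Q. E qs)" using N0(2) by simp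
  also have "\<dots> \<le> (\<Sum>qs\<in>Q. emeasure M (E qs))"
    using finQ E(1) by (intro emeasure_subadditive_finite) auto
  also have "\<dots> \<le> (\<Sum>qs\<in>Q. ennreal (exp (c / 2 - real n * A\<^sup>2 / 8)))"
    using E by (intro sum_mono) auto
  also have "\<dots> = ennreal (real (card Q) * exp (c / 2 - real n * A\<^sup>2 / 8))"
    by (simp add: ennreal_mult ennreal_of_nat_eq_real_of_nat)
  also have "\<dots> \<le> ennreal (N * exp (c / 2 - real n * A\<^sup>2 / 8))"
    using cardQ by (intro ennreal_leI mult_right_mono) auto
  finally show ?thesis .
qed

section \<open>Choice of the constants and the rate\<close>

theorem theorem3p1:
  fixes \<Theta> :: "(real ^ 'd) component set"
    and k kstar :: nat
    and pstar :: "(real ^ 'd) component list"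
    and Gstar :: "(real ^ 'd) atom measure"
    and PX :: "(real ^ 'd) measure"
    and \<X> :: "(real ^ 'd) set"
  assumes "compact \<Theta>"
    and "\<And>\<beta> W a b \<nu>. (\<beta>, W, a, b, \<nu>) \<in> \<Theta> \<Longrightarrow> \<nu> > 0"
    and "Gstar = mixing_measure pstar"
    and "length pstar = kstar" and "kstar \<ge> 1"
    and "set pstar \<subseteq> \<Theta>" and "fst (last pstar) = 0"
    and "k > kstar"
    and "prob_space PX" and "sets PX = sets borel"
    and "bounded \<X>" and "AE x in PX. x \<in> \<X>"
  shows "\<exists>C>0. \<exists>c1>0. \<exists>c2>0. \<forall>n\<ge>1.
    \<forall>(M :: 'w measure) (X :: nat \<Rightarrow> 'w \<Rightarrow> real ^ 'd) (Y :: nat \<Rightarrow> 'w \<Rightarrow> real)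
      (Ghat :: 'w \<Rightarrow> (real ^ 'd) atom measure).
      iid_sample M PX (cond_density Gstar) n X Y \<longrightarrow>
      (\<forall>\<omega>\<in>space M. is_mle k \<Theta> n (\<lambda>i. X i \<omega>) (\<lambda>i. Y i \<omega>) (Ghat \<omega>)) \<longrightarrow>
      outer_measure_of M {\<omega> \<in> space M.
          (\<integral>x. tv_dist (cond_density (Ghat \<omega>) x) (cond_density Gstar x) \<partial>PX)
            > C * sqrt (ln (real n) / real n)}
        \<le> ennreal (c1 * real n powr (- c2))"
proof -
  interpret covariate_law PX
    using assms(9,10) by (simp add: covariate_law_def covariate_law_axioms_def)
  have pos: "0 < variance_of \<theta>" if "\<theta> \<in> \<Theta>" for \<theta>
    using assms(2) that by (cases \<theta>) auto
  have "\<Theta> \<noteq> {}" using assms(4-6) by (cases pstar) auto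
  moreover have "continuous_on \<Theta> variance_of" by (intro continuous_intros)
  ultimately obtain \<theta>0 where "\<theta>0 \<in> \<Theta>" "\<And>\<theta>. \<theta> \<in> \<Theta> \<Longrightarrow> variance_of \<theta>0 \<le> variance_of \<theta>"
    using continuous_attains_inf[OF assms(1)] by blast
  then obtain \<nu>0 where \<nu>0: "0 < \<nu>0" "\<And>\<theta>. \<theta> \<in> \<Theta> \<Longrightarrow> \<nu>0 \<le> variance_of \<theta>"
    using pos by blast
  obtain R where R: "AE x in PX. norm x \<le> R"
  proof -
    from assms(11) obtain R where R: "\<And>x. x \<in> \<X> \<Longrightarrow> norm x \<le> R" by (auto simp: bounded_iff)
    from assms(12) have "AE x in PX. norm x \<le> R" by eventually_elim (rule R)
    then show thesis by (rule that)
  qed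
  have pstar: "mixing_measure pstar \<in> mixing_measures k \<Theta>" "1 \<le> length pstar"
    using assms(4-8) by (auto simp: mixing_measures_def intro!: exI[of _ pstar])
  obtain K where K: "1 \<le> K" "\<And>n::nat. 1 \<le> n \<Longrightarrow> \<exists>T\<subseteq>\<Theta>. finite T \<and>
      real (card T) \<le> K * real n ^ DIM((real ^ 'd) component) \<and> (\<forall>\<theta>\<in>\<Theta>. \<exists>t\<in>T. dist \<theta> t \<le> 1 / real n)"
    using polynomial_net[OF compact_imp_bounded[OF assms(1)]] by blast
  define D where "D = DIM((real ^ 'd) component)"
  define c where "c = 4 + 3 / (2 * \<nu>0) + (R + 1)\<^sup>2 / 2"
  \<comment> \<open>The number of lists from the net is of order n^(D k), so this is the power of n
    to be beaten.\<close>
  define e where "e = real (D * k)"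
  \<comment> \<open>The first summand makes the bracketing error at most half the threshold; the
    second ensures \<open>e + 1 \<le> C\<^sup>2 / 8\<close>, which leaves a factor 1/n after the
    union bound.\<close>
  define C where "C = 2 * (c * exp c) + 8 * (e + 1)"
  \<comment> \<open>The maximum with 1 serves the case n = 1.\<close>
  define c1 where "c1 = max 1 ((real k + 1) * K ^ k * exp (c / 2))"
  have c0: "0 \<le> c" using \<nu>0(1) by (simp add: c_def)
  have "0 \<le> e" by (simp add: e_def)
  then have C8: "8 * (e + 1) \<le> C" "2 * (c * exp c) \<le> C" using c0 by (simp_all add: C_def)
  have "1 \<le> 8 * (e + 1)" using \<open>0 \<le> e\<close> by simp
  then have "1 \<le> C" using C8(1) by (rule order.trans)
  then have C0: "0 < C" by simp
  from \<open>1 \<le> C\<close> have "C \<le> C\<^sup>2" by (simp add: power2_eq_square)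
  then have C2: "real (D * k) + 1 \<le> C\<^sup>2 / 8"
    using order.trans[OF C8(1) \<open>C \<le> C\<^sup>2\<close>] unfolding e_def[symmetric] by simp
  have "outer_measure_of M {\<omega> \<in> space M.
          (\<integral>x. tv_dist (cond_density (Ghat \<omega>) x) (cond_density Gstar x) \<partial>PX)
            > C * sqrt (ln (real n) / real n)}
        \<le> ennreal (c1 * real n powr (- 1))"
    if n: "1 \<le> n" and iid: "iid_sample M PX (cond_density Gstar) n X Y"
      and mle: "\<And>\<omega>. \<omega> \<in> space M \<Longrightarrow> is_mle k \<Theta> n (\<lambda>i. X i \<omega>) (\<lambda>i. Y i \<omega>) (Ghat \<omega>)"
    for n and M :: "'w measure" and X Y Ghat
  proof (cases "n = 1")
    \<comment> \<open>Here \<open>ln 1 = 0\<close> makes the threshold vanish, and the bound holds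
      because probabilities are at most 1.\<close>
    case True
    interpret M: prob_space M using iid by (simp add: iid_sample_def)
    have "outer_measure_of M {\<omega> \<in> space M.
          (\<integral>x. tv_dist (cond_density (Ghat \<omega>) x) (cond_density Gstar x) \<partial>PX)
            > C * sqrt (ln (real n) / real n)} \<le> outer_measure_of M (space M)"
      by (rule outer_measure_of_mono) auto
    also have "\<dots> = ennreal 1" by (simp add: M.emeasure_space_1)
    also have "\<dots> \<le> ennreal (c1 * real n powr (- 1))"
      using True by (intro ennreal_leI) (simp add: c1_def)
    finally show ?thesis .
  next
    case False
    with n have n2: "2 \<le> real n" by simp
    obtain T where T: "T \<subseteq> \<Theta>" "finite T" "real (card T) \<le> K * real n ^ D"
      "\<And>\<theta>. \<theta> \<in> \<Theta> \<Longrightarrow> \<exists>t\<in>T. dist \<theta> t \<le> 1 / real n"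
      using K(2)[OF n] unfolding D_def by blast
    have "1 \<le> K * real n ^ D"
      using K(1) n by (intro mult_ge1_I one_le_power) auto
    note card = card_lists_length_le_bound[OF T(2,3) this, of k]
    define r where "r = sqrt (ln (real n) / real n)"
    \<comment> \<open>From n = 2 on, \<open>ln n * n\<close> is at least 1, so the rate dominates
      the mesh 1/n.\<close>
    have "1 / 2 \<le> ln (real n)"
      using ln2_ge_two_thirds ln_le_cancel_iff[of 2 "real n"] n2 by linarith
    then have "1 \<le> ln (real n) * real n"
      using mult_mono[of "1 / 2" "ln (real n)" 2 "real n"] n2 by simp
    then have "(1 / real n)\<^sup>2 \<le> ln (real n) / real n"
      using n2 by (simp add: power2_eq_square field_simps)
    then have r: "1 / real n \<le> r" unfolding r_def by (rule real_le_rsqrt)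
    have "exp (c / real n) - 1 \<le> c / real n * exp (c / real n)" by (rule exp_diff_one_le)
    also have "\<dots> \<le> c / real n * exp c"
      using c0 n2 by (intro mult_left_mono) (auto simp: divide_le_eq mult_left_mono[of 1 "real n" c, simplified])
    also have "\<dots> = (c * exp c) * (1 / real n)" by simp
    also have "\<dots> \<le> C / 2 * r"
      using C8 C0 c0 r n2 by (intro mult_mono) auto
    finally have thr: "C * r / 2 + (exp (c / real n) - 1) \<le> C * r" by simp
    \<comment> \<open>The tail bound is applied with \<open>A = C * r\<close>: half of the threshold
      is \<open>A / 2\<close>, and the other half covers the bracketing error.\<close>
    have "{\<omega> \<in> space M. (\<integral>x. tv_dist (cond_density (Ghat \<omega>) x) (cond_density Gstar x) \<partial>PX) > C * r}
      \<subseteq> {\<omega> \<in> space M. (\<integral>x. tv_dist (cond_density (Ghat \<omega>) x) (cond_density Gstar x) \<partial>PX)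
          > C * r / 2 + (exp (c / real n) - 1)}"
      using thr by auto
    note outer_measure_of_mono[OF this, of M]
    also have "outer_measure_of M {\<omega> \<in> space M. (\<integral>x. tv_dist (cond_density (Ghat \<omega>) x) (cond_density Gstar x) \<partial>PX)
          > C * r / 2 + (exp (c / real n) - 1)}
      \<le> ennreal (((real k + 1) * (K * real n ^ D) ^ k) * exp (c / 2 - real n * (C * r)\<^sup>2 / 8))"
      unfolding assms(3) c_def
    proof (rule mle_tail_bound)
      show "0 \<le> C * r" using C0 n2 by (simp add: r_def)
    qed (use \<nu>0 pstar assms(6) R n T card iid mle in \<open>simp_all add: assms(3)\<close>)
    also have "\<dots> \<le> ennreal (c1 * real n powr (- 1))"
    proof (rule ennreal_leI)
      \<comment> \<open>The logarithm in the rate turns the exponential bound into the power n^(-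
        C^2 / 8), which then cancels the size of the net.\<close>
      have "real n * (C * r)\<^sup>2 = C\<^sup>2 * ln (real n)"
        using n2 by (simp add: r_def power_mult_distrib)
      then have "exp (c / 2 - real n * (C * r)\<^sup>2 / 8) = exp (c / 2 + - (C\<^sup>2 / 8) * ln (real n))"
        by simp
      also have "\<dots> = exp (c / 2) * real n powr (- (C\<^sup>2 / 8))"
        using n2 by (simp only: exp_add powr_def) simp
      also have "\<dots> \<le> exp (c / 2) * real n powr (- 1 - real (D * k))"
        using C2 n2 by (intro mult_left_mono powr_mono) auto
      also have "real n powr (- 1 - real (D * k)) = real n powr (- 1) / real n ^ (D * k)"
        using n2 unfolding powr_diff by (simp only: powr_realpow)
      finally have "exp (c / 2 - real n * (C * r)\<^sup>2 / 8) \<le> exp (c / 2) * (real n powr (- 1) / real n ^ (D * k))" .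
      then have "((real k + 1) * (K * real n ^ D) ^ k) * exp (c / 2 - real n * (C * r)\<^sup>2 / 8)
          \<le> ((real k + 1) * (K * real n ^ D) ^ k) * (exp (c / 2) * (real n powr (- 1) / real n ^ (D * k)))"
        using K(1) by (intro mult_left_mono) auto
      also have "\<dots> = ((real k + 1) * K ^ k * exp (c / 2)) * real n powr (- 1)"
        using n2 by (simp add: power_mult_distrib power_mult)
      also have "\<dots> \<le> c1 * real n powr (- 1)"
        unfolding c1_def by (intro mult_right_mono) auto
      finally show "((real k + 1) * (K * real n ^ D) ^ k) * exp (c / 2 - real n * (C * r)\<^sup>2 / 8)
          \<le> c1 * real n powr (- 1)" .
    qed
    finally show ?thesis unfolding r_def .
  qed
  note rate = this
  have c1: "0 < c1" by (simp add: c1_def)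
  show ?thesis
    by (rule exI[of _ C], intro conjI C0, rule exI[of _ c1], intro conjI c1, rule exI[of _ 1],
        intro conjI zero_less_one allI impI, rule rate, assumption, assumption, erule (1) bspec)
qed

end
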